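(* There is no nontrivial nilpotent action of a finite group on a free abelian group. That is, if $G$ is a finite group, $A$ is a free abelian group and $\alpha:G\to\mathrm{Aut}(A)$ is a nilpotent action, then $\alpha$ is trivial.
   Context: An action of a group $\pi$ on a group $G$, i.e. a homomorphism $\alpha:\pi\to\mathrm{Aut}(G)$, is nilpotent if there is a finite sequence of subgroups $G=G_1\supset\cdots\supset G_j\supset\cdots\supset G_n=1$ such that for each $j$: $G_j$ is closed under the action of $\pi$; $G_{j+1}$ is normal in $G_j$ and $G_j/G_{j+1}$ is abelian; and the induced action of $\pi$ on $G_j/G_{j+1}$ is trivial. *)

theory Defs
  imports "HOL-Algebra.Bij" "HOL-Algebra.Free_Abelian_Groups"
begin

text \<open>
  The action of \<open>\<pi>\<close> induced by \<open>\<alpha>\<close> on \<open>H / N\<close>, for subgroups \<open>N \<unlhd> H\<close> of \<open>G\<close> that are both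
  closed under \<open>\<alpha>\<close>. Elements of the quotient are cosets, and \<open>\<alpha> g\<close> carries the coset of \<open>x\<close>
  onto the coset of \<open>\<alpha> g x\<close>, because \<open>\<alpha> g\<close> maps \<open>N\<close> onto \<open>N\<close> (\<open>N\<close> is closed under both \<open>g\<close> and
  its inverse). The restriction matches the extensional functions of
  \<^const>\<open>AutoGroup\<close>.
\<close>

definition induced_quotient_action ::
    "('g \<Rightarrow> 'a \<Rightarrow> 'a) \<Rightarrow> ('a, 'b) monoid_scheme \<Rightarrow> 'a set \<Rightarrow> 'a set \<Rightarrow> 'g \<Rightarrow> 'a set \<Rightarrow> 'a set"
  where "induced_quotient_action \<alpha> G H N g =
    (\<lambda>C \<in> carrier (G\<lparr>carrier := H\<rparr> Mod N). \<alpha> g ` C)"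

text \<open>The inclusions \<open>H (Suc j) \<subseteq> H j\<close> are contained in the normality condition; they need not
  be strict.\<close>

definition nilpotent_action ::
    "('g, 'c) monoid_scheme \<Rightarrow> ('a, 'b) monoid_scheme \<Rightarrow> ('g \<Rightarrow> 'a \<Rightarrow> 'a) \<Rightarrow> bool"
  where "nilpotent_action \<pi> G \<alpha> \<longleftrightarrow>
    group_hom \<pi> (AutoGroup G) \<alpha> \<and>
    (\<exists>(n::nat) (H :: nat \<Rightarrow> 'a set).
      n \<ge> 1 \<and> H 1 = carrier G \<and> H n = {\<one>\<^bsub>G\<^esub>} \<and>
      (\<forall>j\<in>{1..n}. subgroup (H j) G \<and>
         (\<forall>g\<in>carrier \<pi>. \<forall>x\<in>H j. \<alpha> g x \<in> H j)) \<and>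
      (\<forall>j\<in>{1..<n}.
         H (Suc j) \<lhd> G\<lparr>carrier := H j\<rparr> \<and>
         comm_group (G\<lparr>carrier := H j\<rparr> Mod H (Suc j)) \<and>
         trivial_homomorphism \<pi> (AutoGroup (G\<lparr>carrier := H j\<rparr> Mod H (Suc j)))
           (induced_quotient_action \<alpha> G (H j) (H (Suc j)))))"

text \<open>A basis of a free abelian group embeds into its carrier, so index sets of type \<open>'a set\<close>
  suffice.\<close>

definition is_free_abelian :: "('a, 'b) monoid_scheme \<Rightarrow> bool"
  where "is_free_abelian A \<longleftrightarrow> group A \<and> (\<exists>S :: 'a set. A \<cong> free_Abelian_group S)"

end

theory Submission
  imports Defs "HOL-Algebra.Multiplicative_Group"
begin

text \<open>
  Every term of the filtration \<open>H\<close> is fixed pointwise, by induction from the bottom up. If \<open>H (Suc j)\<close> is fixed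
  and \<open>x \<in> H j\<close>, triviality on the quotient gives \<open>\<alpha> g x = u x\<close> with \<open>u\<close> fixed, hence
  \<open>\<alpha> (g ^ k) x = u ^ k x\<close>. With \<open>k\<close> the order of the finite group, \<open>u ^ k = 1\<close>, so \<open>u = 1\<close>, as a
  free abelian group is torsion-free.
\<close>

text \<open>Powers here are integer multiples of finitely supported integer-valued functions, so the
  claim reduces, coefficient by coefficient, to the absence of zero divisors in the
  integers.\<close>

lemma free_Abelian_group_torsion_free:
  assumes "u \<in> carrier (free_Abelian_group S)" and "0 < (k::nat)"
    and "u [^]\<^bsub>free_Abelian_group S\<^esub> k = \<one>\<^bsub>free_Abelian_group S\<^esub>"
  shows "u = \<one>\<^bsub>free_Abelian_group S\<^esub>"
proof -
  have "frag_cmul (int k) u = 0"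
    using assms by simp
  then have "int k * Poly_Mapping.lookup u i = 0" for i
    by (metis lookup_frag_cmul lookup_zero)
  then show ?thesis
    using assms(2) by (simp add: poly_mapping_eqI)
qed

text \<open>Torsion-freeness is pulled back along an isomorphism: it preserves powers, and its
  injectivity brings the conclusion back to \<open>A\<close>.\<close>

lemma is_free_abelian_torsion_free:
  assumes "is_free_abelian A" and u: "u \<in> carrier A" and "0 < (k::nat)"
    and pow: "u [^]\<^bsub>A\<^esub> k = \<one>\<^bsub>A\<^esub>"
  shows "u = \<one>\<^bsub>A\<^esub>"
proof -
  from assms(1) obtain S :: "'a set" and f
    where A: "group A" and f: "f \<in> iso A (free_Abelian_group S)"
    unfolding is_free_abelian_def is_iso_def by blast
  interpret group_hom A "free_Abelian_group S" f
    using A f by (simp add: group_hom_def group_hom_axioms_def iso_def)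
  have "f u [^]\<^bsub>free_Abelian_group S\<^esub> k = \<one>\<^bsub>free_Abelian_group S\<^esub>"
    using hom_nat_pow[OF u, of k] pow by (metis hom_one)
  then have "f u = f \<one>\<^bsub>A\<^esub>"
    using free_Abelian_group_torsion_free[OF _ \<open>0 < k\<close>] u by (metis hom_closed hom_one)
  then show ?thesis
    using f u unfolding iso_def bij_betw_def by (blast dest: inj_onD)
qed

lemma one_AutoGroup: "\<one>\<^bsub>AutoGroup G\<^esub> = (\<lambda>x\<in>carrier G. x)"
  by (simp add: AutoGroup_def BijGroup_def)

text \<open>\<open>group_hom\<close> makes only \<pi> and \<open>AutoGroup G\<close> groups;
  \<open>target\<close> adds the group structure of \<open>G\<close> itself.\<close>

locale group_automorphism_action = group_hom \<pi> "AutoGroup G" \<alpha> + target: group G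
  for \<pi> (structure) and G (structure) and \<alpha>
begin

lemma action_in_auto: "g \<in> carrier \<pi> \<Longrightarrow> \<alpha> g \<in> auto G"
  using hom_closed by (simp add: AutoGroup_def)

lemma action_mult:
  "g \<in> carrier \<pi> \<Longrightarrow> x \<in> carrier G \<Longrightarrow> y \<in> carrier G \<Longrightarrow>
    \<alpha> g (x \<otimes>\<^bsub>G\<^esub> y) = \<alpha> g x \<otimes>\<^bsub>G\<^esub> \<alpha> g y"
  using action_in_auto by (auto simp: auto_def hom_def)

lemma action_one: "x \<in> carrier G \<Longrightarrow> \<alpha> \<one>\<^bsub>\<pi>\<^esub> x = x"
  by (simp add: one_AutoGroup)

lemma action_compose:
  assumes "g \<in> carrier \<pi>" "h \<in> carrier \<pi>" "x \<in> carrier G"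
  shows "\<alpha> (g \<otimes>\<^bsub>\<pi>\<^esub> h) x = \<alpha> g (\<alpha> h x)"
proof -
  \<comment> \<open>The product of \<open>BijGroup\<close> is a restricted function, equal to
    composition only for arguments in \<open>Bij\<close>.\<close>
  have "\<alpha> g \<in> Bij (carrier G)" "\<alpha> h \<in> Bij (carrier G)"
    using assms action_in_auto by (auto simp: auto_def)
  then show ?thesis
    using hom_mult[OF assms(1,2)] assms(3)
    by (simp add: AutoGroup_def BijGroup_def compose_def)
qed

text \<open>Since \<open>u\<close> is fixed by the whole action, it passes unchanged through each
  further application of \<open>g\<close>, and every application contributes one more factor
  \<open>u\<close>.\<close>

lemma action_pow:
  assumes g: "g \<in> carrier \<pi>" and x: "x \<in> carrier G" and u: "u \<in> carrier G"
    and fixed: "\<And>h. h \<in> carrier \<pi> \<Longrightarrow> \<alpha> h u = u"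
    and step: "\<alpha> g x = u \<otimes>\<^bsub>G\<^esub> x"
  shows "\<alpha> (g [^]\<^bsub>\<pi>\<^esub> (k::nat)) x = u [^]\<^bsub>G\<^esub> k \<otimes>\<^bsub>G\<^esub> x"
proof (induction k)
  case 0
  show ?case
    using x by (simp add: one_AutoGroup)
next
  case (Suc k)
  have gk: "g [^]\<^bsub>\<pi>\<^esub> k \<in> carrier \<pi>"
    using g by simp
  \<comment> \<open>The power splits with the extra \<open>g\<close> on the right, so
    \<open>g\<close> acts first and \<open>step\<close> rewrites the argument before the induction
    hypothesis is used.\<close>
  have "\<alpha> (g [^]\<^bsub>\<pi>\<^esub> Suc k) x = \<alpha> (g [^]\<^bsub>\<pi>\<^esub> k) (u \<otimes>\<^bsub>G\<^esub> x)"
    using action_compose[OF gk g x] step by simp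
  also have "\<dots> = u \<otimes>\<^bsub>G\<^esub> (u [^]\<^bsub>G\<^esub> k \<otimes>\<^bsub>G\<^esub> x)"
    using action_mult[OF gk u x] fixed[OF gk] Suc.IH by simp
  also have "\<dots> = u [^]\<^bsub>G\<^esub> Suc k \<otimes>\<^bsub>G\<^esub> x"
    using u x by (metis target.m_assoc target.nat_pow_Suc2 target.nat_pow_closed)
  finally show ?case .
qed

text \<open>Triviality means that the right coset of \<open>x\<close> is mapped onto itself as a
  set. It contains \<open>x\<close>, hence also \<open>\<alpha> g x\<close>. Right cosets put
  \<open>u\<close> on the left.\<close>

lemma induced_quotient_action_trivialD:
  assumes N: "N \<lhd> G\<lparr>carrier := H\<rparr>"
    and triv: "trivial_homomorphism \<pi> (AutoGroup (G\<lparr>carrier := H\<rparr> Mod N))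
      (induced_quotient_action \<alpha> G H N)"
    and g: "g \<in> carrier \<pi>" and x: "x \<in> H"
  shows "\<exists>u\<in>N. \<alpha> g x = u \<otimes>\<^bsub>G\<^esub> x"
proof -
  interpret N: normal N "G\<lparr>carrier := H\<rparr>" by (rule N)
  define C where "C = N #>\<^bsub>G\<lparr>carrier := H\<rparr>\<^esub> x"
  have C: "C \<in> carrier (G\<lparr>carrier := H\<rparr> Mod N)"
    using x by (auto simp: C_def FactGroup_def RCOSETS_def)
  have "induced_quotient_action \<alpha> G H N g C = C"
    using triv g C by (simp add: trivial_homomorphism_def one_AutoGroup)
  then have "\<alpha> g ` C = C"
    using C by (simp add: induced_quotient_action_def)
  moreover have "x \<in> C"
    using N.rcos_self[OF _ N.is_subgroup, of x] x by (simp add: C_def)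
  ultimately have "\<alpha> g x \<in> C"
    by blast
  then show ?thesis
    by (auto simp: C_def r_coset_def)
qed

end

theorem theorem6p1:
  fixes G :: "('g, 'c) monoid_scheme" and A :: "('a, 'b) monoid_scheme"
    and \<alpha> :: "'g \<Rightarrow> 'a \<Rightarrow> 'a"
  assumes "group G" and "finite (carrier G)"
    and "is_free_abelian A"
    and "nilpotent_action G A \<alpha>"
  shows "trivial_homomorphism G (AutoGroup A) \<alpha>"
proof -
  have hom: "group_hom G (AutoGroup A) \<alpha>"
    using assms(4) by (simp add: nilpotent_action_def)
  interpret group_automorphism_action G A \<alpha>
    using hom assms(3) by (simp add: group_automorphism_action_def is_free_abelian_def)
  from assms(4) obtain n :: nat and H where n: "1 \<le> n"
    and H1: "H 1 = carrier A" and Hn: "H n = {\<one>\<^bsub>A\<^esub>}"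
    and sub: "\<And>j. j \<in> {1..n} \<Longrightarrow> subgroup (H j) A"
    and closed: "\<And>j g x. j \<in> {1..n} \<Longrightarrow> g \<in> carrier G \<Longrightarrow> x \<in> H j \<Longrightarrow> \<alpha> g x \<in> H j"
    and nrm: "\<And>j. j \<in> {1..<n} \<Longrightarrow> H (Suc j) \<lhd> A\<lparr>carrier := H j\<rparr>"
    and triv: "\<And>j. j \<in> {1..<n} \<Longrightarrow>
      trivial_homomorphism G (AutoGroup (A\<lparr>carrier := H j\<rparr> Mod H (Suc j)))
        (induced_quotient_action \<alpha> A (H j) (H (Suc j)))"
    unfolding nilpotent_action_def by blast
  \<comment> \<open>The induction descends from \<open>n\<close> to 1, so the trivial subgroup
    \<open>H n\<close> is the base and the whole group \<open>H 1\<close> comes last.\<close>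
  have "\<forall>g\<in>carrier G. \<forall>x\<in>H 1. \<alpha> g x = x"
    using n
  proof (induction rule: inc_induct)
    case base
    \<comment> \<open>Closedness alone suffices here, because \<open>H n\<close> is a
      singleton.\<close>
    have "\<alpha> g \<one>\<^bsub>A\<^esub> = \<one>\<^bsub>A\<^esub>" if "g \<in> carrier G" for g
      using closed[of n g "\<one>\<^bsub>A\<^esub>"] that n Hn by simp
    then show ?case
      by (simp add: Hn)
  next
    case (step j)
    show ?case
    proof (intro ballI)
      fix g x
      assume g: "g \<in> carrier G" and x: "x \<in> H j"
      have xA: "x \<in> carrier A"
        using sub[of j] step.hyps x by (auto dest: subgroup.mem_carrier)
      obtain u where u: "u \<in> H (Suc j)" and gx: "\<alpha> g x = u \<otimes>\<^bsub>A\<^esub> x"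
        using induced_quotient_action_trivialD[OF nrm triv g x] step.hyps by auto
      have uA: "u \<in> carrier A"
        using sub[of "Suc j"] step.hyps u by (auto dest: subgroup.mem_carrier)
      \<comment> \<open>The induction hypothesis applies to \<open>u\<close>, which lies in
        \<open>H (Suc j)\<close>, and supplies the fixedness that \<open>action_pow\<close> asks
        for. The exponent is chosen so that the power of \<open>g\<close> is the identity.\<close>
      have "u [^]\<^bsub>A\<^esub> order G \<otimes>\<^bsub>A\<^esub> x = \<alpha> (g [^]\<^bsub>G\<^esub> order G) x"
        using action_pow[OF g xA uA _ gx] step.IH u by simp
      also have "\<dots> = x"
        using action_one[OF xA] G.pow_order_eq_1[OF g] by (simp only:)
      finally have "u [^]\<^bsub>A\<^esub> order G = \<one>\<^bsub>A\<^esub>"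
        using uA xA by simp
      \<comment> \<open>Finiteness of \<open>G\<close> enters here: the order of an infinite group
        is 0 by convention, and a zero exponent would say nothing about \<open>u\<close>.\<close>
      moreover have "0 < order G"
        using assms(2) by (simp add: G.order_gt_0_iff_finite)
      ultimately have "u = \<one>\<^bsub>A\<^esub>"
        using is_free_abelian_torsion_free[OF assms(3) uA] by blast
      then show "\<alpha> g x = x"
        using gx xA by simp
    qed
  qed
  then have fixed: "\<alpha> g x = x" if "g \<in> carrier G" "x \<in> carrier A" for g x
    using that H1 by simp
  have "\<alpha> g = \<one>\<^bsub>AutoGroup A\<^esub>" if g: "g \<in> carrier G" for g
  proof -
    \<comment> \<open>Agreement with the identity on the carrier becomes equality of functions
      because both sides are extensional.\<close>
    have "\<alpha> g \<in> extensional (carrier A)"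
      using action_in_auto[OF g] by (simp add: auto_def Bij_def)
    then have "\<alpha> g = (\<lambda>x\<in>carrier A. x)"
      using fixed[OF g] by (intro extensionalityI[of _ "carrier A"]) auto
    then show ?thesis
      by (simp only: one_AutoGroup)
  qed
  then show ?thesis
    using homh by (simp add: trivial_homomorphism_def)
qed

end
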